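(* Let $n=p^\alpha q^\beta$ where $p<q$ are primes and $\alpha,\beta$ are positive integers, and set $t=p^{\alpha-1}q^{\beta-1}-1$. Then the Laplacian eigenvalues of the comaximal graph $\Gamma(\mathbb{Z}_n)$ are: $n$ with multiplicity $\phi(n)$; $(t+1)(p-1)+\phi(n)$ with multiplicity $(t+1)(q-1)-1$; $(t+1)(q-1)+\phi(n)$ with multiplicity $(t+1)(p-1)-1$; $\phi(n)$ with multiplicity $t+1$; and $(t+1)(p+q-2)+\phi(n)$ and $0$, each with multiplicity $1$.
   Context: The comaximal graph $\Gamma(\mathbb{Z}_n)$ has vertex set $\mathbb{Z}_n=\{0,1,\dots,n-1\}$, distinct $x,y$ adjacent iff $\langle x\rangle+\langle y\rangle=\mathbb{Z}_n$. Its Laplacian matrix is $L=D-A$ ($D$ diagonal degree matrix, $A$ adjacency matrix). $\phi$ is Euler's totient function. A multiplicity of $0$ means the value does not occur. *)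

theory Defs
  imports "HOL-Number_Theory.Residues" "Jordan_Normal_Form.Char_Poly"
begin

definition comaximal :: "nat \<Rightarrow> int \<Rightarrow> int \<Rightarrow> bool" where
  "comaximal n x y \<longleftrightarrow>
     (let R = residue_ring (int n)
      in x \<in> carrier R \<and> y \<in> carrier R \<and> x \<noteq> y \<and>
         (PIdl\<^bsub>R\<^esub> x) <+>\<^bsub>R\<^esub> (PIdl\<^bsub>R\<^esub> y) = carrier R)"

text \<open>A simple graph on the vertices \<open>0, \<dots>, n - 1\<close> is given by its adjacency relation \<open>E\<close>,
  which is meant to be symmetric and irreflexive.\<close>

definition adjacency_mat :: "nat \<Rightarrow> (nat \<Rightarrow> nat \<Rightarrow> bool) \<Rightarrow> real mat" where
  "adjacency_mat n E = mat n n (\<lambda>(i, j). if E i j then 1 else 0)"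

definition degree_mat :: "nat \<Rightarrow> (nat \<Rightarrow> nat \<Rightarrow> bool) \<Rightarrow> real mat" where
  "degree_mat n E = mat n n (\<lambda>(i, j). if i = j then real (card {k. k < n \<and> E i k}) else 0)"

definition laplacian_mat :: "nat \<Rightarrow> (nat \<Rightarrow> nat \<Rightarrow> bool) \<Rightarrow> real mat" where
  "laplacian_mat n E = degree_mat n E - adjacency_mat n E"

text \<open>The carrier of \<open>residue_ring (int n)\<close> is \<open>{0..int n - 1}\<close>, so row and column \<open>i\<close> of the matrix
  belong to the residue \<open>int i\<close>.\<close>

definition comaximal_laplacian :: "nat \<Rightarrow> real mat" where
  "comaximal_laplacian n = laplacian_mat n (\<lambda>i j. comaximal n (int i) (int j))"

text \<open>Algebraic multiplicity; it is \<open>0\<close> exactly when \<open>x\<close> is not an eigenvalue. For the symmetric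
  real matrices above it agrees with the dimension of the eigenspace.\<close>

definition eigenvalue_mult :: "real mat \<Rightarrow> real \<Rightarrow> nat" where
  "eigenvalue_mult A x = Polynomial.order x (char_poly A)"

end

theory Submission
  imports Defs
begin

text \<open>Two distinct residues are adjacent iff neither \<open>p\<close> nor \<open>q\<close> divides both, so adjacency depends only on
  which of \<open>p\<close>, \<open>q\<close> divide the two endpoints. On each of the four resulting classes the Laplacian
  acts on differences of two basis vectors as a scalar, and the vectors constant on classes span a
  four-dimensional invariant subspace with explicit eigenvectors. Together these form an eigenbasis,
  so the multiplicity of a value is the number of basis vectors belonging to it.\<close>

section \<open>Characteristic polynomials and multiplicities read off from an eigenbasis\<close>

lemma order_prod_list_linear:
  "Polynomial.order x (\<Prod>a\<leftarrow>xs. [:- a, 1:]) = count_list xs (x :: 'a :: idom)"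
proof (induction xs)
  case Nil
  then show ?case
    by (simp add: order_0I)
next
  case (Cons a xs)
  have "(\<Prod>a\<leftarrow>xs. [:- a, 1:]) \<noteq> (0 :: 'a poly)"
    by (auto simp: prod_list_zero_iff)
  then have "Polynomial.order x (\<Prod>a\<leftarrow>a # xs. [:- a, 1:])
      = Polynomial.order x [:- a, 1:] + Polynomial.order x (\<Prod>a\<leftarrow>xs. [:- a, 1:])"
    unfolding list.map prod_list.Cons by (intro order_mult no_zero_divisors) auto
  moreover have "Polynomial.order x [:- a, 1:] = (if a = x then 1 else 0)"
    using order_power_n_n[of x 1] by (auto intro!: order_0I)
  ultimately show ?case
    using Cons.IH by simp
qed

text \<open>The vectors \<open>f j\<close> become the columns of a matrix \<open>P\<close>.
  Independence makes \<open>P\<close> invertible and the eigenvalue equations say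
  \<open>A * P = P * mat_diag n d\<close>, so \<open>A\<close> is similar to a diagonal
  matrix.\<close>

lemma char_poly_eigenbasis:
  fixes A :: "'a :: field mat"
  assumes A: "A \<in> carrier_mat n n"
    and eigen: "\<And>i j. i < n \<Longrightarrow> j < n \<Longrightarrow> (\<Sum>k<n. A $$ (i, k) * f j k) = d j * f j i"
    and indep: "\<And>v j. (\<And>i. i < n \<Longrightarrow> (\<Sum>j<n. v j * f j i) = 0) \<Longrightarrow> j < n \<Longrightarrow> v j = 0"
  shows "char_poly A = (\<Prod>a\<leftarrow>map d [0..<n]. [:- a, 1:])"
proof -
  define P where "P = mat n n (\<lambda>(i, j). f j i)"
  have P: "P \<in> carrier_mat n n"
    by (simp add: P_def)
  \<comment> \<open>A nonzero kernel vector of \<open>P\<close> would be a nontrivial linear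
    relation among the \<open>f j\<close>.\<close>
  have "det P \<noteq> 0"
  proof
    assume "det P = 0"
    then obtain v where v: "v \<in> carrier_vec n" "v \<noteq> 0\<^sub>v n" "P *\<^sub>v v = 0\<^sub>v n"
      using det_0_iff_vec_prod_zero[OF P] by blast
    have "(\<Sum>j<n. v $ j * f j i) = 0" if "i < n" for i
    proof -
      have "(P *\<^sub>v v) $ i = (\<Sum>j<n. v $ j * f j i)"
        using that v(1) by (simp add: P_def scalar_prod_def mult.commute atLeast0LessThan)
      then show ?thesis
        using v(3) that by simp
    qed
    then have "v $ j = 0" if "j < n" for j
      using indep[of "\<lambda>j. v $ j"] that by blast
    then have "v = 0\<^sub>v n"
      using v(1) by (intro eq_vecI) auto
    with v(2) show False by simp
  qed
  then have "P \<in> Units (ring_mat TYPE('a) n ())"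
    by (rule det_non_zero_imp_unit[OF P])
  then obtain Q where Q: "Q \<in> carrier_mat n n" and QP: "Q * P = 1\<^sub>m n" and PQ: "P * Q = 1\<^sub>m n"
    by (auto simp: Units_def ring_mat_def)
  have "A * P = P * mat_diag n d"
  proof (rule eq_matI)
    fix i j assume "i < dim_row (P * mat_diag n d)" "j < dim_col (P * mat_diag n d)"
    then have ij: "i < n" "j < n"
      using P by (auto simp: mat_diag_def)
    have "(A * P) $$ (i, j) = (\<Sum>k<n. A $$ (i, k) * f j k)"
      using ij A by (simp add: P_def scalar_prod_def atLeast0LessThan)
    then show "(A * P) $$ (i, j) = (P * mat_diag n d) $$ (i, j)"
      using ij eigen[OF ij] by (simp add: mat_diag_mult_right[OF P]) (simp add: P_def)
  qed (use A P in \<open>auto simp: mat_diag_def\<close>)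
  then have "P * mat_diag n d * Q = A * P * Q" by simp
  also have "\<dots> = A"
    using A P Q PQ by simp
  finally have "similar_mat A (mat_diag n d)"
    unfolding similar_mat_def similar_mat_wit_def
    using A P Q PQ QP by (intro exI[of _ P] exI[of _ Q]) (auto simp: Let_def)
  then have "char_poly A = char_poly (mat_diag n d)"
    by (rule char_poly_similar)
  also have "\<dots> = (\<Prod>a\<leftarrow>diag_mat (mat_diag n d). [:- a, 1:])"
    by (rule char_poly_upper_triangular[of _ n]) (auto simp: mat_diag_def upper_triangular_def)
  also have "diag_mat (mat_diag n d) = map d [0..<n]"
    by (auto simp: diag_mat_def mat_diag_def)
  finally show ?thesis .
qed

lemma eigenvalue_mult_char_poly_split:
  fixes A :: "real mat"
  assumes "char_poly A = (\<Prod>a\<leftarrow>map d [0..<n]. [:- a, 1:])"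
  shows "eigenvalue_mult A x = card {i. i < n \<and> d i = x}"
proof -
  have "eigenvalue_mult A x = count_list (map d [0..<n]) x"
    unfolding eigenvalue_mult_def assms by (rule order_prod_list_linear)
  also have "\<dots> = card {i. i < n \<and> d i = x}"
    by (auto simp: count_list_eq_length_filter length_filter_conv_card intro!: arg_cong[where f = card])
  finally show ?thesis .
qed

lemma eigenvalue_iff_char_poly_split:
  fixes A :: "'a :: field mat"
  assumes "A \<in> carrier_mat n n" and "char_poly A = (\<Prod>a\<leftarrow>map d [0..<n]. [:- a, 1:])"
  shows "eigenvalue A x \<longleftrightarrow> (\<exists>i<n. d i = x)"
  unfolding eigenvalue_root_char_poly[OF assms(1)] assms(2)
  by (auto simp: poly_prod_list prod_list_zero_iff o_def)

section \<open>Action of a graph Laplacian, and an arithmetic criterion for comaximality\<close>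

lemma sum_laplacian_mat:
  assumes "i < n"
  shows "(\<Sum>k<n. laplacian_mat n E $$ (i, k) * f k) = (\<Sum>k | k < n \<and> E i k. f i - f k)"
proof -
  let ?N = "{k. k < n \<and> E i k}"
  have "(\<Sum>k<n. laplacian_mat n E $$ (i, k) * f k)
      = (\<Sum>k<n. (if i = k then real (card ?N) * f k else 0) - (if E i k then f k else 0))"
    using assms by (intro sum.cong)
      (auto simp: laplacian_mat_def degree_mat_def adjacency_mat_def algebra_simps)
  also have "\<dots> = real (card ?N) * f i - (\<Sum>k<n. if E i k then f k else 0)"
    using assms by (simp add: sum_subtractf)
  also have "(\<Sum>k<n. if E i k then f k else 0) = (\<Sum>k\<in>?N. f k)"
    by (simp add: sum.inter_filter[symmetric] flip: lessThan_iff)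
  finally show ?thesis
    by (simp add: sum_subtractf)
qed

text \<open>The ideal sum consists of the residues of all combinations of \<open>i\<close> and
  \<open>j\<close>. By Bezout it contains 1 exactly when \<open>i\<close>, \<open>j\<close> and
  \<open>n\<close> have no common prime factor.\<close>

lemma comaximal_iff:
  assumes n: "n > 1"
  shows "comaximal n (int i) (int j) \<longleftrightarrow> i < n \<and> j < n \<and> i \<noteq> j \<and> coprime (gcd i j) n"
proof (cases "i < n \<and> j < n")
  case True
  define R where "R = residue_ring (int n)"
  interpret residues "int n" R
    using n by unfold_locales (auto simp: R_def)
  have carr: "carrier R = {0..int n - 1}"
    by (simp add: res_carrier_eq)
  have ij: "int i \<in> carrier R" "int j \<in> carrier R"
    using True by (auto simp: carr)
  have mem: "x \<in> (PIdl\<^bsub>R\<^esub> int i) <+>\<^bsub>R\<^esub> (PIdl\<^bsub>R\<^esub> int j) \<longleftrightarrow>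
      (\<exists>r\<in>carrier R. \<exists>s\<in>carrier R. x = (r * int i + s * int j) mod int n)" for x
  proof -
    have "x \<in> (PIdl\<^bsub>R\<^esub> int i) <+>\<^bsub>R\<^esub> (PIdl\<^bsub>R\<^esub> int j) \<longleftrightarrow>
        (\<exists>r\<in>carrier R. \<exists>s\<in>carrier R. x = (r * int i mod int n + s * int j mod int n) mod int n)"
      unfolding set_add_def' cgenideal_def res_add_eq res_mult_eq by blast
    then show ?thesis
      by (simp only: mod_add_eq)
  qed
  have "(PIdl\<^bsub>R\<^esub> int i) <+>\<^bsub>R\<^esub> (PIdl\<^bsub>R\<^esub> int j) = carrier R \<longleftrightarrow> coprime (gcd i j) n"
  proof
    assume eq: "(PIdl\<^bsub>R\<^esub> int i) <+>\<^bsub>R\<^esub> (PIdl\<^bsub>R\<^esub> int j) = carrier R"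
    have "1 \<in> carrier R"
      using n by (auto simp: carr)
    then obtain r s where rs: "1 = (r * int i + s * int j) mod int n"
      unfolding eq[symmetric] mem by blast
    show "coprime (gcd i j) n"
    proof (rule coprimeI)
      fix d assume "d dvd gcd i j" "d dvd n"
      then have "int d dvd r * int i + s * int j" "int d dvd int n"
        by auto
      then have "int d dvd (r * int i + s * int j) mod int n"
        by (simp add: dvd_mod)
      then show "is_unit d"
        using rs by simp
    qed
  next
    assume "coprime (gcd i j) n"
    then have "coprime (gcd (int i) (int j)) (int n)"
      by (simp add: gcd_int_int_eq)
    then obtain a b where ab: "a * gcd (int i) (int j) + b * int n = 1"
      using bezout_int[of "gcd (int i) (int j)" "int n"] by (auto simp: coprime_iff_gcd_eq_1)
    obtain u v where uv: "u * int i + v * int j = gcd (int i) (int j)"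
      using bezout_int by blast
    show "(PIdl\<^bsub>R\<^esub> int i) <+>\<^bsub>R\<^esub> (PIdl\<^bsub>R\<^esub> int j) = carrier R"
    proof (intro equalityI subsetI)
      fix x assume "x \<in> (PIdl\<^bsub>R\<^esub> int i) <+>\<^bsub>R\<^esub> (PIdl\<^bsub>R\<^esub> int j)"
      then show "x \<in> carrier R"
        using n by (auto simp: mem carr)
    next
      fix x assume "x \<in> carrier R"
      \<comment> \<open>The two Bezout identities \<open>uv\<close> and \<open>ab\<close>, combined
        and scaled by \<open>x\<close>, exhibit \<open>x\<close> as a combination of
        \<open>i\<close> and \<open>j\<close> modulo \<open>n\<close>.\<close>
      have "x = x * (a * (u * int i + v * int j) + b * int n)"
        by (simp only: uv ab mult_1_right)
      also have "\<dots> = (x * a * u) * int i + (x * a * v) * int j + x * b * int n"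
        by (simp add: algebra_simps)
      finally have "x mod int n = ((x * a * u) * int i + (x * a * v) * int j) mod int n"
        by (metis mod_mult_self1 mult.commute)
      moreover have "x mod int n = x"
        using \<open>x \<in> carrier R\<close> by (simp add: carr)
      \<comment> \<open>The coefficients are reduced modulo \<open>n\<close> because
        \<open>mem\<close> requires them to lie in the carrier.\<close>
      ultimately have "x = ((x * a * u mod int n) * int i + (x * a * v mod int n) * int j) mod int n"
        by (metis mod_add_eq mod_mult_left_eq)
      moreover have "y mod int n \<in> carrier R" for y
        using n by (simp add: carr)
      ultimately show "x \<in> (PIdl\<^bsub>R\<^esub> int i) <+>\<^bsub>R\<^esub> (PIdl\<^bsub>R\<^esub> int j)"
        unfolding mem by blast
    qed
  qed
  then show ?thesis
    using True ij by (simp add: comaximal_def Let_def flip: R_def)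
qed (auto simp: comaximal_def Let_def residue_ring_def)

lemma card_multiples_lessThan:
  fixes d k :: nat
  assumes "d > 0"
  shows "card {i. i < d * k \<and> d dvd i} = k"
proof -
  have "{i. i < d * k \<and> d dvd i} = (\<lambda>i. d * i) ` {..<k}"
    using assms by (auto elim!: dvdE)
  then show ?thesis
    using assms by (simp add: card_image inj_on_def)
qed

section \<open>The four divisibility classes of residues and their sizes\<close>

locale two_prime_powers =
  fixes p q \<alpha> \<beta> :: nat
  assumes prime_p: "Factorial_Ring.prime p" and prime_q: "Factorial_Ring.prime q" and p_less_q: "p < q"
    and \<alpha>_pos: "\<alpha> > 0" and \<beta>_pos: "\<beta> > 0"
begin

definition n :: nat where "n = p ^ \<alpha> * q ^ \<beta>"
text \<open>This is \<open>n\<close> divided by \<open>p * q\<close>, the quantity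
  \<open>t + 1\<close> of the theorem.\<close>

definition m :: nat where "m = p ^ (\<alpha> - 1) * q ^ (\<beta> - 1)"

text \<open>Keeps the simplifier from turning the representative \<open>1\<close> into
  \<open>Suc 0\<close>, so that terms such as \<open>cls 1\<close> keep their shape.\<close>

declare One_nat_def [simp del]

lemma p_gt_1: "p > 1" and q_gt_1: "q > 1"
  using prime_p prime_q by (auto simp: prime_gt_1_nat)

lemma m_pos: "m > 0"
  using p_gt_1 q_gt_1 by (simp add: m_def)

lemma n_eq: "n = p * q * m"
  unfolding n_def m_def power_minus_mult[OF \<alpha>_pos, symmetric] power_minus_mult[OF \<beta>_pos, symmetric]
  by (simp add: mult_ac)

lemma pq_le_n: "p * q \<le> n"
  using m_pos by (simp add: n_eq)

lemma q_less_n: "q < n"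
proof -
  have "q < p * q" using p_gt_1 q_gt_1 by simp
  then show ?thesis using pq_le_n by (rule less_le_trans)
qed

lemma coprime_p_q: "coprime p q"
  using prime_p prime_q p_less_q by (intro primes_coprime) auto

lemma coprime_n_iff: "coprime x n \<longleftrightarrow> \<not> p dvd x \<and> \<not> q dvd x"
proof -
  have "coprime x n \<longleftrightarrow> coprime p x \<and> coprime q x"
    using \<alpha>_pos \<beta>_pos by (auto simp: n_def coprime_commute)
  then show ?thesis
    using prime_p prime_q by (auto simp: prime_imp_coprime_nat dest: coprime_common_divisor_nat)
qed

lemma comaximal_n_iff:
  "comaximal n (int i) (int j) \<longleftrightarrow>
     i < n \<and> j < n \<and> i \<noteq> j \<and> \<not> (p dvd i \<and> p dvd j) \<and> \<not> (q dvd i \<and> q dvd j)"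
  using q_less_n q_gt_1 by (subst comaximal_iff) (auto simp: coprime_n_iff)

text \<open>Each class is named by one of its own members, so the same four numbers serve as class
  labels and as vertices.\<close>

definition rep :: "nat \<Rightarrow> nat" where
  "rep i = (if p dvd i then if q dvd i then 0 else p else if q dvd i then q else 1)"

definition cls :: "nat \<Rightarrow> nat set" where
  "cls c = {i. i < n \<and> rep i = c}"

definition reps :: "nat set" where
  "reps = {0, 1, p, q}"

lemma rep_distinct [simp]: "p \<noteq> q" "q \<noteq> p" "p \<noteq> 0" "q \<noteq> 0" "p \<noteq> 1" "q \<noteq> 1"
    "p \<noteq> Suc 0" "q \<noteq> Suc 0" "p > 0" "q > 0"
  using p_less_q p_gt_1 q_gt_1 by auto

lemma not_dvd: "\<not> p dvd q" "\<not> q dvd p"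
  using prime_p prime_q p_less_q by (auto simp: primes_dvd_imp_eq dest: primes_dvd_imp_eq)

lemma rep_simps [simp]: "rep 0 = 0" "rep 1 = 1" "rep (Suc 0) = 1" "rep p = p" "rep q = q"
  using p_gt_1 q_gt_1 not_dvd by (auto simp: rep_def)

lemma rep_in_reps: "rep i \<in> reps"
  by (auto simp: rep_def reps_def)

lemma rep_cases: "rep i = 1 \<or> rep i = p \<or> rep i = q \<or> rep i = 0"
  by (simp add: rep_def)

lemma rep_rep [simp]: "rep (rep i) = rep i"
  using rep_in_reps[of i] by (auto simp: reps_def)

lemma rep_eq_self_iff: "rep i = i \<longleftrightarrow> i \<in> reps"
  using rep_in_reps[of i] by (auto simp: reps_def)

lemma reps_less_n: "c \<in> reps \<Longrightarrow> c < n"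
  using q_less_n p_less_q p_gt_1 by (auto simp: reps_def)

lemma finite_cls [simp]: "finite (cls c)"
  by (simp add: cls_def)

lemma sum_classes: "(\<Sum>i<n. f i) = sum f (cls 1) + sum f (cls p) + sum f (cls q) + sum f (cls 0)"
proof -
  have eq: "{..<n} = cls 1 \<union> cls p \<union> cls q \<union> cls 0"
    using rep_in_reps unfolding cls_def reps_def by blast
  have disj: "cls c \<inter> cls d = {}" if "c \<noteq> d" for c d
    using that by (auto simp: cls_def)
  show ?thesis
    unfolding eq by (simp add: sum.union_disjoint Int_Un_distrib2 disj)
qed

lemma card_cls_0: "card (cls 0) = m"
proof -
  have "cls 0 = {i. i < p * q * m \<and> p * q dvd i}"
    using divides_mult[OF _ _ coprime_p_q] by (auto simp: cls_def rep_def n_eq dest: dvd_mult_left dvd_mult_right)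
  then show ?thesis
    by (simp add: card_multiples_lessThan)
qed

text \<open>There are \<open>q * m\<close> multiples of \<open>p\<close> below \<open>n\<close>; the
  \<open>m\<close> multiples of \<open>p * q\<close> among them form \<open>cls 0\<close>.\<close>

lemma card_cls_p: "card (cls p) = m * (q - 1)"
proof -
  have "{i. i < p * (q * m) \<and> p dvd i} = cls p \<union> cls 0" "cls p \<inter> cls 0 = {}"
    by (auto simp: cls_def rep_def n_eq mult.assoc split: if_splits)
  then have "card (cls p) + card (cls 0) = q * m"
    using card_multiples_lessThan[of p "q * m"] by (simp add: card_Un_disjoint)
  then show ?thesis
    by (simp add: card_cls_0 diff_mult_distrib diff_mult_distrib2 mult.commute[of m])
qed

lemma card_cls_q: "card (cls q) = m * (p - 1)"
proof -
  have "{i. i < q * (p * m) \<and> q dvd i} = cls q \<union> cls 0" "cls q \<inter> cls 0 = {}"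
    by (auto simp: cls_def rep_def n_eq mult_ac split: if_splits)
  then have "card (cls q) + card (cls 0) = p * m"
    using card_multiples_lessThan[of q "p * m"] by (simp add: card_Un_disjoint)
  then show ?thesis
    by (simp add: card_cls_0 diff_mult_distrib diff_mult_distrib2 mult.commute[of m])
qed

lemma card_cls_1: "card (cls 1) = totient n"
proof -
  have "cls 1 = {i. i < n \<and> coprime i n}"
    by (auto simp: cls_def rep_def coprime_n_iff)
  also have "\<dots> = totatives n"
    \<comment> \<open>\<open>totatives\<close> ranges over 1 to \<open>n\<close> instead of 0 to
      \<open>n - 1\<close>; as \<open>n > 1\<close>, neither 0 nor \<open>n\<close> is coprime to
      \<open>n\<close>.\<close>
    using q_less_n q_gt_1 by (force simp: totatives_def intro!: Nat.gr0I dest: le_neq_implies_less)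
  finally show ?thesis
    by (simp add: totient_def)
qed

text \<open>The primes cross over in the sizes: \<open>a\<close>, for multiples of \<open>p\<close>
  only, is \<open>m * (q - 1)\<close>, while \<open>b\<close>, for multiples of \<open>q\<close>
  only, is \<open>m * (p - 1)\<close>.\<close>

definition u :: real where "u = real (card (cls 1))"
definition a :: real where "a = real (card (cls p))"
definition b :: real where "b = real (card (cls q))"
definition z :: real where "z = real (card (cls 0))"

text \<open>Each representative belongs to its own class.\<close>

lemma card_cls_pos: "c \<in> reps \<Longrightarrow> card (cls c) > 0"
  using reps_less_n rep_eq_self_iff by (auto simp: card_gt_0_iff cls_def)

lemma sizes_pos: "u > 0" "a > 0" "b > 0" "z > 0"
  using card_cls_pos by (simp_all add: u_def a_def b_def z_def reps_def)

lemma n_eq_sizes: "real n = u + a + b + z"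
  using sum_classes[of "\<lambda>_. 1 :: real"] by (simp add: u_def a_def b_def z_def)

text \<open>Keeps the values \<open>u + a\<close> and \<open>u + b\<close> apart, so that their
  multiplicities do not merge.\<close>

lemma b_less_a: "b < a"
  using m_pos p_less_q p_gt_1 by (auto simp: a_def b_def card_cls_p card_cls_q)

section \<open>Eigenvectors of the comaximal Laplacian and their independence\<close>

abbreviation L :: "real mat" where "L \<equiv> comaximal_laplacian n"

lemma L_carrier: "L \<in> carrier_mat n n"
  unfolding comaximal_laplacian_def laplacian_mat_def degree_mat_def adjacency_mat_def
  by (intro minus_carrier_mat mat_carrier)

text \<open>Neighbourhoods are unions of classes, except that a unit is joined to every vertex but
  itself. Hence a row of \<open>L\<close> sees \<open>f\<close> only through \<open>f i\<close> and
  the class sums.\<close>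

lemma sum_L:
  assumes i: "i < n"
  shows "(\<Sum>k<n. L $$ (i, k) * f k) =
    (if rep i = 1 then (u + a + b + z) * f i - (sum f (cls 1) + sum f (cls p) + sum f (cls q) + sum f (cls 0))
     else if rep i = p then (u + b) * f i - (sum f (cls 1) + sum f (cls q))
     else if rep i = q then (u + a) * f i - (sum f (cls 1) + sum f (cls p))
     else u * f i - sum f (cls 1))"
proof -
  let ?N = "{k. k < n \<and> comaximal n (int i) (int k)}"
  have sum_f: "(\<Sum>k<n. L $$ (i, k) * f k) = (\<Sum>k\<in>?N. f i - f k)"
    unfolding comaximal_laplacian_def by (rule sum_laplacian_mat[OF i])
  have disj: "cls 1 \<inter> cls q = {}" "cls 1 \<inter> cls p = {}"
    by (auto simp: cls_def)
  consider "rep i = 1" | "rep i = p" | "rep i = q" | "rep i = 0"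
    using rep_cases by metis
  then show ?thesis
  proof cases
    case 1
    then have "?N = {..<n} - {i}"
      using i by (auto simp: comaximal_n_iff rep_def split: if_splits)
    \<comment> \<open>Adding the vertex \<open>i\<close> itself costs nothing, since its summand is
      zero.\<close>
    then have "(\<Sum>k\<in>?N. f i - f k) = (\<Sum>k<n. f i - f k)"
      using i by (simp add: sum_diff1)
    then show ?thesis
      using 1 by (simp add: sum_f sum_subtractf n_eq_sizes sum_classes[of f])
  next
    case 2
    then have N: "?N = cls 1 \<union> cls q"
      using i by (auto simp: comaximal_n_iff rep_def cls_def split: if_splits)
    show ?thesis
      unfolding sum_f N using 2
      by (simp add: sum.union_disjoint card_Un_disjoint disj sum_subtractf u_def b_def algebra_simps)
  next
    case 3
    then have N: "?N = cls 1 \<union> cls p"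
      using i by (auto simp: comaximal_n_iff rep_def cls_def split: if_splits)
    show ?thesis
      unfolding sum_f N using 3
      by (simp add: sum.union_disjoint card_Un_disjoint disj sum_subtractf u_def a_def algebra_simps)
  next
    case 4
    then have N: "?N = cls 1"
      using i by (auto simp: comaximal_n_iff rep_def cls_def split: if_splits)
    show ?thesis
      unfolding sum_f N using 4
      by (simp add: sum_subtractf u_def algebra_simps)
  qed
qed

text \<open>The vectors \<open>class_vec j\<close> are eigenvectors of the quotient matrix on the four classes. They
  are indexed by the class representatives because the differences \<open>e\<^sub>j - e\<^bsub>rep j\<^esub>\<close>, which vanish
  for \<open>j\<close> a representative, leave exactly these indices free.\<close>

definition class_vec :: "nat \<Rightarrow> nat \<Rightarrow> real" where
  "class_vec j c =
     (if j = 1 then if c = 1 then a + b + z else - u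
      else if j = p then if c = p then b else if c = q then - a else 0
      else if j = q then 1
      else if c = 1 then 0 else if c = 0 then - (a + b) else z)"

definition eigvec :: "nat \<Rightarrow> nat \<Rightarrow> real" where
  "eigvec j i = (if j \<in> reps then class_vec j (rep i) else of_bool (i = j) - of_bool (i = rep j))"

text \<open>A difference vector gets the coefficient of \<open>f i\<close> in \<open>sum_L\<close>
  for its class. The vectors indexed by 1 and 0 share the value of their class; those indexed by
  \<open>p\<close> and \<open>q\<close> carry \<open>u + a + b\<close> and 0 instead.\<close>

definition eigval :: "nat \<Rightarrow> real" where
  "eigval j =
     (if rep j = 1 then u + a + b + z
      else if rep j = 0 then u
      else if rep j = p then if j = p then u + a + b else u + b
      else if j = q then 0 else u + a)"

text \<open>For a non-representative \<open>j\<close> the entries 1 at \<open>j\<close> and -1 at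
  \<open>rep j\<close> lie in the same class and cancel.\<close>

lemma sum_eigvec_cls:
  assumes "j < n"
  shows "sum (eigvec j) (cls c) = (if j \<in> reps then real (card (cls c)) * class_vec j c else 0)"
proof (cases "j \<in> reps")
  case True
  have "sum (eigvec j) (cls c) = (\<Sum>i\<in>cls c. class_vec j c)"
    using True by (intro sum.cong) (auto simp: eigvec_def cls_def)
  with True show ?thesis by simp
next
  case False
  have "j \<in> cls c \<longleftrightarrow> rep j \<in> cls c"
    using assms reps_less_n[OF rep_in_reps] by (simp add: cls_def)
  with False show ?thesis
    by (simp add: eigvec_def[abs_def] sum_subtractf of_bool_def)
qed

text \<open>By \<open>sum_eigvec_cls\<close> the class sums in \<open>sum_L\<close> are explicit.
  For representatives this leaves a polynomial identity in the class sizes; for difference vectors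
  all class sums vanish and only the \<open>f i\<close> term survives.\<close>

lemma L_eigvec:
  assumes ij: "i < n" "j < n"
  shows "(\<Sum>k<n. L $$ (i, k) * eigvec j k) = eigval j * eigvec j i"
proof (cases "j \<in> reps")
  case True
  then have "j = 1 \<or> j = p \<or> j = q \<or> j = 0"
    by (auto simp: reps_def)
  moreover have "eigvec j i = class_vec j (rep i)"
    using True by (simp add: eigvec_def)
  ultimately show ?thesis
    using True rep_cases[of i]
    unfolding sum_L[OF ij(1)] sum_eigvec_cls[OF ij(2)]
    by (elim disjE) (simp_all add: class_vec_def eigval_def algebra_simps flip: u_def a_def b_def z_def)
next
  case False
  \<comment> \<open>A difference vector is supported in one class, so outside it both sides of the
    eigenvalue equation are zero.\<close>
  have "eigvec j i = 0" if "rep i \<noteq> rep j"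
    using that False by (auto simp: eigvec_def)
  moreover have "j \<noteq> p" "j \<noteq> q"
    using False by (auto simp: reps_def)
  ultimately show ?thesis
    using False rep_cases[of j]
    unfolding sum_L[OF ij(1)] sum_eigvec_cls[OF ij(2)]
    by (cases "rep i = rep j"; elim disjE) (simp_all add: eigval_def)
qed

text \<open>Summing a relation over a class removes the difference vectors and leaves a 4 by 4
  system for the coefficients at representatives. Once these vanish, the entry at a
  non-representative \<open>j\<close> isolates \<open>v j\<close>.\<close>

lemma eigvec_independent:
  assumes comb: "\<And>i. i < n \<Longrightarrow> (\<Sum>j<n. v j * eigvec j i) = 0" and j: "j < n"
  shows "v j = 0"
proof -
  have quot: "(\<Sum>j\<in>reps. v j * class_vec j c) = 0" if c: "c \<in> reps" for c
  proof -
    have "0 = (\<Sum>i\<in>cls c. \<Sum>j<n. v j * eigvec j i)"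
      using comb by (simp add: cls_def)
    also have "\<dots> = (\<Sum>j<n. v j * sum (eigvec j) (cls c))"
      by (subst sum.swap) (simp add: sum_distrib_left)
    also have "\<dots> = (\<Sum>j<n. if j \<in> reps then real (card (cls c)) * (v j * class_vec j c) else 0)"
      by (intro sum.cong) (auto simp: sum_eigvec_cls)
    also have "\<dots> = (\<Sum>j\<in>reps. real (card (cls c)) * (v j * class_vec j c))"
      by (intro sum.mono_neutral_cong_right) (auto dest: reps_less_n)
    also have "\<dots> = real (card (cls c)) * (\<Sum>j\<in>reps. v j * class_vec j c)"
      by (simp add: sum_distrib_left)
    \<comment> \<open>The class size is nonzero and can be cancelled.\<close>
    finally show ?thesis
      using card_cls_pos[OF c] by (metis mult_eq_0_iff of_nat_eq_0_iff less_numeral_extra(3))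
  qed
  have eqs: "v 1 * (a + b + z) + v q = 0"
      "- v 1 * u + v p * b + v q + v 0 * z = 0"
      "- v 1 * u - v p * a + v q + v 0 * z = 0"
      "- v 1 * u + v q - v 0 * (a + b) = 0"
    using quot[of 1] quot[of p] quot[of q] quot[of 0]
    by (simp_all add: reps_def class_vec_def algebra_simps)
  have "v p * (a + b) = 0"
    using eqs(2,3) by (simp add: algebra_simps)
  then have vp: "v p = 0"
    using sizes_pos by simp
  \<comment> \<open>Difference of the equations for the classes of \<open>p\<close> and 0; the
    \<open>v 1\<close> and \<open>v q\<close> terms cancel.\<close>
  have "v 0 * (a + b + z) = 0"
    using eqs(2,4) vp by (simp add: algebra_simps)
  then have v0: "v 0 = 0"
    using sizes_pos by simp
  have "v 1 * (u + a + b + z) = 0"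
    using eqs(1,4) v0 by (simp add: algebra_simps)
  then have v1: "v 1 = 0"
    using sizes_pos by simp
  then have vq: "v q = 0"
    using eqs(1) by simp
  have v_reps: "v k = 0" if "k \<in> reps" for k
    using that vp v0 v1 vq by (auto simp: reps_def)
  show ?thesis
  proof (cases "j \<in> reps")
    case False
    \<comment> \<open>The negative entry of a difference vector sits at a representative, so among
      these vectors only the one indexed by \<open>j\<close> is nonzero at position
      \<open>j\<close>.\<close>
    have "v k * eigvec k j = (if k = j then v j else 0)" for k
      using False v_reps[of k] rep_in_reps[of k] by (auto simp: eigvec_def)
    then show ?thesis
      using comb[OF j] j by simp
  qed (rule v_reps)
qed

lemma char_poly_L: "char_poly L = (\<Prod>x\<leftarrow>map eigval [0..<n]. [:- x, 1:])"
  using L_carrier L_eigvec eigvec_independent by (rule char_poly_eigenbasis)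

section \<open>Counting the indices that belong to each eigenvalue\<close>

lemma eigval_eq_iff:
  assumes "i < n"
  shows "eigval i = u + a + b + z \<longleftrightarrow> i \<in> cls 1"
    and "eigval i = u + b \<longleftrightarrow> i \<in> cls p - {p}"
    and "eigval i = u + a \<longleftrightarrow> i \<in> cls q - {q}"
    and "eigval i = u \<longleftrightarrow> i \<in> cls 0"
    and "eigval i = u + a + b \<longleftrightarrow> i = p"
    and "eigval i = 0 \<longleftrightarrow> i = q"
proof -
  have "i \<in> cls c \<longleftrightarrow> rep i = c" for c
    using assms by (simp add: cls_def)
  moreover have "rep i \<noteq> rep c \<Longrightarrow> i \<noteq> c" for c
    by blast
  \<comment> \<open>Positivity of the sizes and \<open>b < a\<close> give the strict chain from 0
    through \<open>u\<close>, \<open>u + b\<close>, \<open>u + a\<close>, \<open>u + a + b\<close>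
    to \<open>u + a + b + z\<close>, so the six values are distinct.\<close>
  moreover note rep_cases[of i] this[of p] this[of q] sizes_pos b_less_a
  ultimately show "eigval i = u + a + b + z \<longleftrightarrow> i \<in> cls 1"
    and "eigval i = u + b \<longleftrightarrow> i \<in> cls p - {p}"
    and "eigval i = u + a \<longleftrightarrow> i \<in> cls q - {q}"
    and "eigval i = u \<longleftrightarrow> i \<in> cls 0"
    and "eigval i = u + a + b \<longleftrightarrow> i = p"
    and "eigval i = 0 \<longleftrightarrow> i = q"
    by (elim disjE; simp add: eigval_def)+
qed

lemma eigenvalue_mult_L:
  "eigenvalue_mult L (u + a + b + z) = card (cls 1)"
  "eigenvalue_mult L (u + b) = card (cls p) - 1"
  "eigenvalue_mult L (u + a) = card (cls q) - 1"
  "eigenvalue_mult L u = card (cls 0)"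
  "eigenvalue_mult L (u + a + b) = 1"
  "eigenvalue_mult L 0 = 1"
proof -
  have mult: "eigenvalue_mult L x = card S"
    if "\<And>i. i < n \<Longrightarrow> eigval i = x \<longleftrightarrow> i \<in> S" "S \<subseteq> {..<n}" for x S
    unfolding eigenvalue_mult_char_poly_split[OF char_poly_L]
    using that by (intro arg_cong[where f = card]) auto
  have less: "p < n" "q < n" and mem: "p \<in> cls p" "q \<in> cls q"
    using reps_less_n by (auto simp: reps_def cls_def)
  have cls: "cls c \<subseteq> {..<n}" for c
    by (auto simp: cls_def)
  show "eigenvalue_mult L (u + a + b + z) = card (cls 1)" "eigenvalue_mult L u = card (cls 0)"
    using cls by (auto intro!: mult simp: eigval_eq_iff)
  show "eigenvalue_mult L (u + b) = card (cls p) - 1"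
    using mult[of "u + b" "cls p - {p}"] cls mem by (auto simp: eigval_eq_iff)
  show "eigenvalue_mult L (u + a) = card (cls q) - 1"
    using mult[of "u + a" "cls q - {q}"] cls mem by (auto simp: eigval_eq_iff)
  show "eigenvalue_mult L (u + a + b) = 1"
    using mult[of "u + a + b" "{p}"] less by (auto simp: eigval_eq_iff)
  show "eigenvalue_mult L 0 = 1"
    using mult[of 0 "{q}"] less by (auto simp: eigval_eq_iff)
qed

text \<open>Only an inclusion holds in general: for \<open>n = 2 * q\<close> the class of
  \<open>q\<close> is a singleton, and \<open>u + a\<close> then has multiplicity 0.\<close>

lemma eigenvalue_L_subset:
  "{x. eigenvalue L x} \<subseteq> {u + a + b + z, u + b, u + a, u, u + a + b, 0}"
  unfolding eigenvalue_iff_char_poly_split[OF L_carrier char_poly_L] by (auto simp: eigval_def)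

end

section \<open>Class sizes expressed through \<open>t\<close>, the primes and the totient\<close>

theorem theorem3p12:
  fixes n p q \<alpha> \<beta> t :: nat and L :: "real mat"
  assumes "Factorial_Ring.prime p" and "Factorial_Ring.prime q" and "p < q"
    and "\<alpha> > 0" and "\<beta> > 0"
    and "n = p ^ \<alpha> * q ^ \<beta>"
    and "t = p ^ (\<alpha> - 1) * q ^ (\<beta> - 1) - 1"
    and "L = comaximal_laplacian n"
  shows "{x. eigenvalue L x} \<subseteq>
           {real n,
            real ((t + 1) * (p - 1) + totient n),
            real ((t + 1) * (q - 1) + totient n),
            real (totient n),
            real ((t + 1) * (p + q - 2) + totient n),
            0}
       \<and> eigenvalue_mult L (real n) = totient n
       \<and> eigenvalue_mult L (real ((t + 1) * (p - 1) + totient n)) = (t + 1) * (q - 1) - 1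
       \<and> eigenvalue_mult L (real ((t + 1) * (q - 1) + totient n)) = (t + 1) * (p - 1) - 1
       \<and> eigenvalue_mult L (real (totient n)) = t + 1
       \<and> eigenvalue_mult L (real ((t + 1) * (p + q - 2) + totient n)) = 1
       \<and> eigenvalue_mult L 0 = 1"
proof -
  interpret G: two_prime_powers p q \<alpha> \<beta>
    using assms(1-5) by unfold_locales
  have n: "n = G.n"
    by (simp only: assms(6) G.n_def)
  \<comment> \<open>Since \<open>G.m\<close> is positive, the truncated subtraction in
    \<open>t\<close> is undone by adding 1.\<close>
  have t: "t + 1 = G.m"
    using G.m_pos unfolding assms(7) G.m_def[symmetric] by simp
  have u: "real (totient n) = G.u"
    unfolding n G.u_def G.card_cls_1 ..
  have a: "real ((t + 1) * (q - 1)) = G.a" and b: "real ((t + 1) * (p - 1)) = G.b"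
    unfolding t G.a_def G.b_def G.card_cls_p G.card_cls_q by simp_all
  \<comment> \<open>Valid for truncated subtraction because both primes exceed 1.\<close>
  have "p + q - 2 = (p - 1) + (q - 1)"
    using G.p_gt_1 G.q_gt_1 by simp
  then have ab: "real ((t + 1) * (p + q - 2)) = G.a + G.b"
    unfolding a[symmetric] b[symmetric] by (simp only: distrib_left of_nat_add add.commute)
  have eigvals: "real n = G.u + G.a + G.b + G.z"
    "real ((t + 1) * (p - 1) + totient n) = G.u + G.b"
    "real ((t + 1) * (q - 1) + totient n) = G.u + G.a"
    "real ((t + 1) * (p + q - 2) + totient n) = G.u + G.a + G.b"
    unfolding of_nat_add[of _ "totient n"] a b ab u by (simp_all add: n G.n_eq_sizes)
  have L: "L = comaximal_laplacian G.n"
    using assms(8) n by simp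
  show ?thesis
    unfolding eigvals u L
    using G.eigenvalue_L_subset G.eigenvalue_mult_L
    by (simp add: t G.card_cls_p G.card_cls_q G.card_cls_0 G.card_cls_1 flip: n)
qed

end
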